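(* Let $(L,A,[\cdot,\cdots,\cdot],\rho)$ be an $n$-Lie Rinehart algebra, $(M,\psi)$ a representation of $L$, and $\theta:\wedge^nL\to M$ a linear map. Then $\theta$ is a $2$-cocycle associated with $(M,\psi)$ if and only if $(L\oplus M,A,[\cdot,\cdots,\cdot]_\theta,\rho_\theta)$ is an $n$-Lie Rinehart algebra, where $$[x_1+m_1,\cdots,x_n+m_n]_\theta=[x_1,\cdots,x_n]+\theta(x_1,\cdots,x_n)+\sum_{i=1}^n(-1)^{n-i}\psi(x_1,\cdots,\widehat{x_i},\cdots,x_n)m_i,$$ $\rho_\theta:\wedge^{n-1}(L\oplus M)\to\mathrm{Der}(A)$ is given by $$\rho_\theta(x_1+m_1,\cdots,x_{n-1}+m_{n-1})=\rho(x_1,\cdots,x_{n-1}),$$ and $A$ acts on $L\oplus M$ via $a(x_1+m_1)=ax_1+am_1$, for all $x_1,\cdots,x_n\in L$, $m_1,\cdots,m_n\in M$ and $a\in A$.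
   Context: All vector spaces are over a field $\mathbb{K}$ of characteristic $0$, and $n\ge 2$ is a fixed integer. A hat denotes omission. $\mathrm{Der}(A)$ is the space of $\mathbb K$-linear derivations of $A$; $\mathrm{End}(M)$ is the space of $\mathbb K$-linear endomorphisms of $M$. An $n$-Lie algebra is a vector space $L$ with a skew-symmetric $n$-linear bracket $[\cdot,\cdots,\cdot]:\wedge^nL\to L$ satisfying $$[x_1,\cdots,x_{n-1},[y_1,\cdots,y_n]]=\sum_{i=1}^n[y_1,\cdots,y_{i-1},[x_1,\cdots,x_{n-1},y_i],y_{i+1},\cdots,y_n].$$ A representation of an $n$-Lie algebra $L$ on a vector space $M$ is a linear map $\rho:\wedge^{n-1}L\to\mathfrak{gl}(M)$ such that for all $x_i,y_i\in L$: $$\rho(x_1,\cdots,x_{n-1})\circ\rho(y_1,\cdots,y_{n-1})-\rho(y_1,\cdots,y_{n-1})\circ\rho(x_1,\cdots,x_{n-1})=\sum_{i=1}^{n-1}\rho(y_1,\cdots,y_{i-1},[x_1,\cdots,x_{n-1},y_i],y_{i+1},\cdots,y_{n-1}),$$ $$\rho(x_1,\cdots,x_{n-2},[y_1,\cdots,y_n])=\sum_{i=1}^n(-1)^{n-i}\rho(y_1,\cdots,\widehat{y_i},\cdots,y_n)\circ\rho(x_1,\cdots,x_{n-2},y_i).$$ An $n$-Lie Rinehart algebra over $A$ is a tuple $(L,A,[\cdot,\cdots,\cdot],\rho)$ where $A$ is an associative commutative algebra, $L$ is an $A$-module, $[\cdot,\cdots,\cdot]$ is a skew-symmetric $n$-linear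 map $L\times\cdots\times L\to L$, and $\rho:\wedge^{n-1}L\to\mathrm{Der}(A)$ is a linear map, such that: (1) $(L,[\cdot,\cdots,\cdot])$ is an $n$-Lie algebra; (2) $\rho$ is a representation of $(L,[\cdot,\cdots,\cdot])$ on $A$; (3) $\rho(ax_1,x_2,\cdots,x_{n-1})=a\rho(x_1,\cdots,x_{n-1})$; (4) $[x_1,\cdots,x_{n-1},ax_n]=a[x_1,\cdots,x_n]+\rho(x_1,\cdots,x_{n-1})(a)\,x_n$, for all $x_i\in L$, $a\in A$. A representation of the $n$-Lie Rinehart algebra $(L,A,[\cdot,\cdots,\cdot],\rho)$ is a pair $(M,\psi)$, with $M$ an $A$-module and $\psi:\wedge^{n-1}L\to\mathrm{End}(M)$ linear, such that: (1) $\psi$ is a representation of the $n$-Lie algebra $(L,[\cdot,\cdots,\cdot])$ on $M$; (2) $\psi(ax_1,x_2,\cdots,x_{n-1})=a\psi(x_1,\cdots,x_{n-1})$; (3) $\psi(x_1,\cdots,x_{n-1})(am)=a\psi(x_1,\cdots,x_{n-1})(m)+\rho(x_1,\cdots,x_{n-1})(a)\,m$, for all $x_i\in L$, $a\in A$, $m\in M$. A $2$-cochain is a linear map $\theta:\wedge^nL\to M$ (skew-symmetric) that is $A$-linear in each argument: $\theta(x_1,\cdots,ax_i,\cdots,x_n)=a\theta(x_1,\cdots,x_n)$. A $2$-cocycle associated with $(M,\psi)$ is a $2$-cochain $\theta$ satisfying, for all $x_1,\cdots,x_n,y_1,\cdots,y_{n-1}\in L$, $$\theta(y_1,\cdots,y_{n-1},[x_1,\cdots,x_n])=\sum_{i=1}^n\theta(x_1,\cdots,[y_1,\cdots,y_{n-1},x_i],\cdots,x_n)+\sum_{i=1}^n(-1)^{n-i}\psi(x_1,\cdots,\widehat{x_i},\cdots,x_n)\theta(y_1,\cdots,y_{n-1},x_i)-\psi(y_1,\cdots,y_{n-1})\theta(x_1,\cdots,x_n).$$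 *)

theory Defs
  imports Complex_Main "HOL-Library.Product_Plus"
begin

text \<open>
  An \<open>n\<close>-ary operation is a function on lists, of which only the values on lists of length \<open>n\<close>
  matter; positions are counted from \<open>0\<close>, so the sign \<open>(-1)\<close> to the power \<open>n - i\<close> belonging to
  the \<open>i\<close>-th argument in the usual \<open>1\<close>-based numbering reads \<open>(- 1) ^ (n - 1 - i)\<close> below.
\<close>

definition omit :: "nat \<Rightarrow> 'v list \<Rightarrow> 'v list" where
  "omit i xs = take i xs @ drop (Suc i) xs"

text \<open>
  Linear maps on the \<open>n\<close>-th exterior power of a vector space are identified with the
  skew-symmetric \<open>n\<close>-linear maps.
\<close>

definition skew_multilinear ::
    "nat \<Rightarrow> ('k::field_char_0 \<Rightarrow> 'v::ab_group_add \<Rightarrow> 'v) \<Rightarrow> ('k \<Rightarrow> 'w::ab_group_add \<Rightarrow> 'w)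
      \<Rightarrow> ('v list \<Rightarrow> 'w) \<Rightarrow> bool" where
  "skew_multilinear n sV sW f \<longleftrightarrow>
     (\<forall>xs i. length xs = n \<longrightarrow> i < n \<longrightarrow> Vector_Spaces.linear sV sW (\<lambda>x. f (xs[i := x]))) \<and>
     (\<forall>xs i j. length xs = n \<longrightarrow> i < j \<longrightarrow> j < n \<longrightarrow> f (xs[i := xs ! j, j := xs ! i]) = - f xs)"

locale n_Lie_algebra = vector_space sL
  for n :: nat
    and sL :: "'k::field_char_0 \<Rightarrow> 'l::ab_group_add \<Rightarrow> 'l"
    and br :: "'l list \<Rightarrow> 'l" +
  assumes n_ge_2: "2 \<le> n"
    and br_skew_multilinear: "skew_multilinear n sL sL br"
    and fundamental_identity:
      "\<lbrakk>length xs = n - 1; length ys = n\<rbrakk> \<Longrightarrow>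
         br (xs @ [br ys]) = (\<Sum>i<n. br (ys[i := br (xs @ [ys ! i])]))"

text \<open>
  The vector space structure on endomorphisms being pointwise, linearity of a map into them is
  stated after evaluation at an arbitrary vector.
\<close>

locale n_Lie_representation = n_Lie_algebra n sL br + M: vector_space sM
  for n :: nat
    and sL :: "'k::field_char_0 \<Rightarrow> 'l::ab_group_add \<Rightarrow> 'l"
    and br :: "'l list \<Rightarrow> 'l"
    and sM :: "'k \<Rightarrow> 'm::ab_group_add \<Rightarrow> 'm"
    and rho :: "'l list \<Rightarrow> 'm \<Rightarrow> 'm" +
  assumes rho_endomorphism:
      "length xs = n - 1 \<Longrightarrow> Vector_Spaces.linear sM sM (rho xs)"
    and rho_skew_multilinear:
      "skew_multilinear (n - 1) sL sM (\<lambda>xs. rho xs m)"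
    and rho_commutator:
      "\<lbrakk>length xs = n - 1; length ys = n - 1\<rbrakk> \<Longrightarrow>
         rho xs (rho ys m) - rho ys (rho xs m)
           = (\<Sum>i<n - 1. rho (ys[i := br (xs @ [ys ! i])]) m)"
    and rho_bracket:
      "\<lbrakk>length xs = n - 2; length ys = n\<rbrakk> \<Longrightarrow>
         rho (xs @ [br ys]) m
           = (\<Sum>i<n. sM ((- 1) ^ (n - 1 - i)) (rho (omit i ys) (rho (xs @ [ys ! i]) m)))"

text \<open>
  Algebras are associative and commutative but need not have an identity, which is why the
  library locale \<open>module\<close> is not available.  If there is an identity, modules are required to
  be unital; for \<open>comm_ring_1\<close> types the lemma below recovers the library notion.
\<close>

locale commutative_algebra = vector_space sA
  for sA :: "'k::field_char_0 \<Rightarrow> 'a::comm_ring \<Rightarrow> 'a" +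
  assumes scale_mult: "sA k (a * b) = sA k a * b"

locale algebra_module = commutative_algebra sA + M: vector_space sM
  for sA :: "'k::field_char_0 \<Rightarrow> 'a::comm_ring \<Rightarrow> 'a"
    and sM :: "'k \<Rightarrow> 'm::ab_group_add \<Rightarrow> 'm"
    and act :: "'a \<Rightarrow> 'm \<Rightarrow> 'm" +
  assumes act_linear: "Vector_Spaces.linear sM sM (act a)"
    and linear_act: "Vector_Spaces.linear sA sM (\<lambda>a. act a m)"
    and act_act: "act a (act b m) = act (a * b) m"
    and act_unital: "(\<And>a. e * a = a) \<Longrightarrow> act e m = m"

lemma algebra_module_iff_module:
  fixes sA :: "'k::field_char_0 \<Rightarrow> 'a::comm_ring_1 \<Rightarrow> 'a"
  shows "algebra_module sA sM act \<longleftrightarrow>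
    commutative_algebra sA \<and> vector_space sM \<and> module act \<and>
    (\<forall>k a m. act (sA k a) m = sM k (act a m) \<and> act a (sM k m) = sM k (act a m))"
    (is "?L \<longleftrightarrow> ?R")
proof
  assume ?L
  then interpret algebra_module sA sM act .
  interpret l: Vector_Spaces.linear sM sM "act a" for a by (rule act_linear)
  interpret r: Vector_Spaces.linear sA sM "\<lambda>a. act a m" for m by (rule linear_act)
  have "module act"
    by unfold_locales (auto simp: l.add r.add act_act intro: act_unital)
  then show ?R
    by (auto simp: l.scale r.scale commutative_algebra_axioms M.vector_space_axioms)
next
  assume R: ?R
  then interpret commutative_algebra sA by simp
  interpret M: vector_space sM using R by simp
  interpret A: module act using R by simp
  show ?L
  proof
    show "act e m = m" if "\<And>a. e * a = a" for e m
      using that[of 1] by simp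
  qed (use R in \<open>auto simp: A.scale_right_distrib A.scale_left_distrib\<close>)
qed

definition derivation :: "('k::field_char_0 \<Rightarrow> 'a::comm_ring \<Rightarrow> 'a) \<Rightarrow> ('a \<Rightarrow> 'a) \<Rightarrow> bool" where
  "derivation sA D \<longleftrightarrow>
     Vector_Spaces.linear sA sA D \<and> (\<forall>a b. D (a * b) = D a * b + a * D b)"

locale n_Lie_Rinehart =
  algebra_module sA sL aL + n_Lie_representation n sL br sA rho
  for n :: nat
    and sA :: "'k::field_char_0 \<Rightarrow> 'a::comm_ring \<Rightarrow> 'a"
    and sL :: "'k \<Rightarrow> 'l::ab_group_add \<Rightarrow> 'l"
    and aL :: "'a \<Rightarrow> 'l \<Rightarrow> 'l"
    and br :: "'l list \<Rightarrow> 'l"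
    and rho :: "'l list \<Rightarrow> 'a \<Rightarrow> 'a" +
  assumes rho_derivation: "length xs = n - 1 \<Longrightarrow> derivation sA (rho xs)"
    and rho_act: "length xs = n - 2 \<Longrightarrow> rho (aL a x # xs) b = a * rho (x # xs) b"
    and br_act: "length xs = n - 1 \<Longrightarrow>
      br (xs @ [aL a x]) = aL a (br (xs @ [x])) + aL (rho xs a) x"

locale n_Lie_Rinehart_representation =
  n_Lie_Rinehart n sA sL aL br rho +
  M: algebra_module sA sM aM +
  M: n_Lie_representation n sL br sM psi
  for n :: nat
    and sA :: "'k::field_char_0 \<Rightarrow> 'a::comm_ring \<Rightarrow> 'a"
    and sL :: "'k \<Rightarrow> 'l::ab_group_add \<Rightarrow> 'l"
    and aL :: "'a \<Rightarrow> 'l \<Rightarrow> 'l"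
    and br :: "'l list \<Rightarrow> 'l"
    and rho :: "'l list \<Rightarrow> 'a \<Rightarrow> 'a"
    and sM :: "'k \<Rightarrow> 'm::ab_group_add \<Rightarrow> 'm"
    and aM :: "'a \<Rightarrow> 'm \<Rightarrow> 'm"
    and psi :: "'l list \<Rightarrow> 'm \<Rightarrow> 'm" +
  assumes psi_act: "length xs = n - 2 \<Longrightarrow> psi (aL a x # xs) m = aM a (psi (x # xs) m)"
    and psi_Leibniz: "length xs = n - 1 \<Longrightarrow>
      psi xs (aM a m) = aM a (psi xs m) + aM (rho xs a) m"

definition two_cochain ::
    "nat \<Rightarrow> ('k::field_char_0 \<Rightarrow> 'l::ab_group_add \<Rightarrow> 'l) \<Rightarrow> ('a \<Rightarrow> 'l \<Rightarrow> 'l)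
      \<Rightarrow> ('k \<Rightarrow> 'm::ab_group_add \<Rightarrow> 'm) \<Rightarrow> ('a \<Rightarrow> 'm \<Rightarrow> 'm) \<Rightarrow> ('l list \<Rightarrow> 'm) \<Rightarrow> bool" where
  "two_cochain n sL aL sM aM theta \<longleftrightarrow>
     skew_multilinear n sL sM theta \<and>
     (\<forall>xs i a. length xs = n \<longrightarrow> i < n \<longrightarrow>
        theta (xs[i := aL a (xs ! i)]) = aM a (theta xs))"

definition two_cocycle ::
    "nat \<Rightarrow> ('k::field_char_0 \<Rightarrow> 'l::ab_group_add \<Rightarrow> 'l) \<Rightarrow> ('a \<Rightarrow> 'l \<Rightarrow> 'l) \<Rightarrow> ('l list \<Rightarrow> 'l)
      \<Rightarrow> ('k \<Rightarrow> 'm::ab_group_add \<Rightarrow> 'm) \<Rightarrow> ('a \<Rightarrow> 'm \<Rightarrow> 'm) \<Rightarrow> ('l list \<Rightarrow> 'm \<Rightarrow> 'm)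
      \<Rightarrow> ('l list \<Rightarrow> 'm) \<Rightarrow> bool" where
  "two_cocycle n sL aL br sM aM psi theta \<longleftrightarrow>
     two_cochain n sL aL sM aM theta \<and>
     (\<forall>xs ys. length xs = n \<longrightarrow> length ys = n - 1 \<longrightarrow>
        theta (ys @ [br xs])
          = (\<Sum>i<n. theta (xs[i := br (ys @ [xs ! i])]))
            + (\<Sum>i<n. sM ((- 1) ^ (n - 1 - i)) (psi (omit i xs) (theta (ys @ [xs ! i]))))
            - psi ys (theta xs))"

text \<open>The direct sum of \<open>L\<close> and \<open>M\<close> is the product type, with componentwise operations.\<close>

definition sum_scale :: "('s \<Rightarrow> 'l \<Rightarrow> 'l) \<Rightarrow> ('s \<Rightarrow> 'm \<Rightarrow> 'm) \<Rightarrow> 's \<Rightarrow> 'l \<times> 'm \<Rightarrow> 'l \<times> 'm" where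
  "sum_scale f g s = map_prod (f s) (g s)"

definition ext_bracket ::
    "nat \<Rightarrow> ('l list \<Rightarrow> 'l) \<Rightarrow> ('k::field_char_0 \<Rightarrow> 'm::ab_group_add \<Rightarrow> 'm)
      \<Rightarrow> ('l list \<Rightarrow> 'm \<Rightarrow> 'm) \<Rightarrow> ('l list \<Rightarrow> 'm) \<Rightarrow> ('l \<times> 'm) list \<Rightarrow> 'l \<times> 'm" where
  "ext_bracket n br sM psi theta zs =
     (br (map fst zs),
      theta (map fst zs)
        + (\<Sum>i<n. sM ((- 1) ^ (n - 1 - i)) (psi (omit i (map fst zs)) (snd (zs ! i)))))"

definition ext_anchor :: "('l list \<Rightarrow> 'a \<Rightarrow> 'a) \<Rightarrow> ('l \<times> 'm) list \<Rightarrow> 'a \<Rightarrow> 'a" where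
  "ext_anchor rho zs = rho (map fst zs)"

end

theory Submission
  imports Defs
begin

text \<open>
  A copy of \<open>M\<close> in \<open>L \<oplus> M\<close> brackets trivially with itself, so the fundamental identity for
  \<open>L \<oplus> M\<close> is affine in the \<open>M\<close>-components of all arguments.  Its constant part is the cocycle
  equation, the part linear in the components of the outer arguments is the bracket axiom of the
  representation \<open>\<psi>\<close>, and the part linear in the components of the inner arguments is its
  commutator axiom.  In the same way the Leibniz rule of \<open>L \<oplus> M\<close> amounts to that of \<open>\<psi>\<close>
  together with \<open>A\<close>-linearity of \<open>\<theta>\<close> in the last argument, which skew symmetry carries over to
  the other arguments.
\<close>

section \<open>Lists with an omitted entry\<close>

lemma length_omit: "k < length xs \<Longrightarrow> length (omit k xs) = length xs - 1"
  by (simp add: omit_def)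

lemma nth_omit:
  "k < length xs \<Longrightarrow> i < length xs - 1 \<Longrightarrow> omit k xs ! i = xs ! (if i < k then i else Suc i)"
  by (auto simp: omit_def nth_append min_def)

lemma map_omit: "map f (omit k xs) = omit k (map f xs)"
  by (simp add: omit_def take_map drop_map)

lemma omit_update_same: "omit k (xs[k := x]) = omit k xs"
  by (simp add: omit_def)

lemma omit_update:
  assumes "k < length xs" "i < length xs" "i \<noteq> k"
  shows "omit k (xs[i := x]) = (omit k xs)[(if i < k then i else i - 1) := x]"
proof (rule nth_equalityI)
  fix j
  assume "j < length (omit k (xs[i := x]))"
  then show "omit k (xs[i := x]) ! j = (omit k xs)[(if i < k then i else i - 1) := x] ! j"
    using assms by (cases "i < k") (auto simp: length_omit nth_omit nth_list_update)
qed (use assms in \<open>simp add: length_omit\<close>)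

lemma omit_append:
  "k < length xs \<Longrightarrow> omit k (xs @ [x]) = omit k xs @ [x]"
  "k = length xs \<Longrightarrow> omit k (xs @ [x]) = xs"
  by (simp_all add: omit_def)

text \<open>Because the positions are neighbours, the surviving entry lands exactly where it stands
  in the other shortened list. For distant positions a cyclic shift would remain, which is why skew
  symmetry of \<open>correction\<close> is checked on adjacent swaps.\<close>

lemma omit_swap_adjacent:
  assumes "Suc i < length xs"
  shows "omit i (xs[i := xs ! Suc i, Suc i := xs ! i]) = omit (Suc i) xs"
    and "omit (Suc i) (xs[i := xs ! Suc i, Suc i := xs ! i]) = omit i xs"
  by (rule nth_equalityI; use assms in \<open>auto simp: length_omit nth_omit nth_list_update less_Suc_eq\<close>)+

text \<open>Bridges the commutator axiom, which sums over positions of the shortened list, and sums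
  over positions of the full list. The bijection skips \<open>k\<close>, and its inverse closes the
  gap.\<close>

lemma sum_update_omit:
  fixes h :: "'v list \<Rightarrow> 'w::comm_monoid_add"
  assumes "k < n" "length xs = n"
  shows "(\<Sum>i<n - 1. h ((omit k xs)[i := F (omit k xs ! i)]))
    = (\<Sum>i\<in>{..<n} - {k}. h (omit k (xs[i := F (xs ! i)])))"
  by (rule sum.reindex_bij_witness[where j = "\<lambda>i. if i < k then i else Suc i"
        and i = "\<lambda>i. if i < k then i else i - 1"])
    (use assms in \<open>auto simp: nth_omit omit_update\<close>)

section \<open>Skew-symmetric multilinear maps\<close>

lemma skew_multilinear_linear:
  "skew_multilinear n sV sW f \<Longrightarrow> length xs = n \<Longrightarrow> i < n
    \<Longrightarrow> Vector_Spaces.linear sV sW (\<lambda>x. f (xs[i := x]))"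
  by (simp add: skew_multilinear_def)

lemma skew_multilinear_swap:
  "skew_multilinear n sV sW f \<Longrightarrow> length xs = n \<Longrightarrow> i < j \<Longrightarrow> j < n
    \<Longrightarrow> f (xs[i := xs ! j, j := xs ! i]) = - f xs"
  by (simp add: skew_multilinear_def)

text \<open>The transposition of \<open>i\<close> and \<open>j\<close> is that of \<open>i + 1\<close> and \<open>j\<close> conjugated with that of \<open>i\<close>
  and \<open>i + 1\<close>, which contributes three signs.\<close>

lemma skew_if_adjacent_skew:
  fixes f :: "'v list \<Rightarrow> 'w::ab_group_add"
  assumes adjacent: "\<And>xs i. length xs = n \<Longrightarrow> Suc i < n
      \<Longrightarrow> f (xs[i := xs ! Suc i, Suc i := xs ! i]) = - f xs"
    and "length xs = n" "i < j" "j < n"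
  shows "f (xs[i := xs ! j, j := xs ! i]) = - f xs"
  using assms(3,2,4)
proof (induction i arbitrary: xs rule: strict_inc_induct)
  case (base i)
  then show ?case using adjacent by simp
next
  case (step i)
  define ys where "ys = xs[i := xs ! Suc i, Suc i := xs ! i]"
  define zs where "zs = ys[Suc i := ys ! j, j := ys ! Suc i]"
  have "xs[i := xs ! j, j := xs ! i] = zs[i := zs ! Suc i, Suc i := zs ! i]"
    by (rule nth_equalityI) (use step in \<open>auto simp: ys_def zs_def nth_list_update\<close>)
  also have "f \<dots> = - f zs"
    using step by (intro adjacent) (auto simp: ys_def zs_def)
  also have "f zs = - f ys"
    unfolding zs_def using step by (intro step.IH) (auto simp: ys_def)
  also have "f ys = - f xs"
    unfolding ys_def using step by (intro adjacent) auto
  finally show ?case by simp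
qed

text \<open>Conjugation with the transposition of \<open>p\<close> and \<open>q\<close> moves the
  update from one slot to the other; the two signs cancel because \<open>T\<close> is odd. It serves
  to transport \<open>A\<close>-linearity between argument positions.\<close>

lemma skew_update_transfer:
  fixes f :: "'v::ab_group_add list \<Rightarrow> 'w::ab_group_add"
  assumes skew: "skew_multilinear n sV sW f"
    and minus: "\<And>w. T (- w) = - T w"
    and p: "p < n" "\<And>xs. length xs = n \<Longrightarrow> f (xs[p := S (xs ! p)]) = T (f xs)"
    and "length xs = n" "q < n"
  shows "f (xs[q := S (xs ! q)]) = T (f xs)"
proof (cases "p = q")
  case False
  \<comment> \<open>\<open>skew_multilinear\<close> provides transpositions only for an increasing
    pair of positions, hence \<open>min\<close> and \<open>max\<close>.\<close>
  define swap where "swap = (\<lambda>xs :: 'v list. xs[min p q := xs ! max p q, max p q := xs ! min p q])"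
  have swap: "f (swap xs) = - f xs" if "length xs = n" for xs
    unfolding swap_def using that assms False
    by (intro skew_multilinear_swap[OF skew]) auto
  have len: "length (swap xs) = length xs" for xs
    by (simp add: swap_def)
  have "swap (xs[q := S (xs ! q)]) = (swap xs)[p := S (swap xs ! p)]"
    by (rule nth_equalityI)
      (use assms False in \<open>auto simp: swap_def nth_list_update min_def max_def\<close>)
  then have "- f (xs[q := S (xs ! q)]) = f ((swap xs)[p := S (swap xs ! p)])"
    using swap[of "xs[q := S (xs ! q)]"] assms by simp
  also have "\<dots> = - T (f xs)"
    using assms by (simp add: p(2) len swap minus)
  finally show ?thesis by simp
qed (use assms in auto)

text \<open>With \<open>g = fst\<close> this pulls skew multilinear maps on \<open>L\<close> back to
  the direct sum.\<close>

lemma skew_multilinear_compose: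
  fixes g :: "'u::ab_group_add \<Rightarrow> 'v::ab_group_add"
  assumes f: "skew_multilinear n sV sW f" and g: "Vector_Spaces.linear sU sV g"
  shows "skew_multilinear n sU sW (\<lambda>xs. f (map g xs))"
  unfolding skew_multilinear_def
proof (intro conjI allI impI)
  fix xs :: "'u list" and i
  assume "length xs = n" "i < n"
  then show "Vector_Spaces.linear sU sW (\<lambda>x. f (map g (xs[i := x])))"
    using skew_multilinear_linear[OF f, of "map g xs" i] g
    by (simp add: Vector_Spaces.linear_iff map_update)
next
  fix xs :: "'u list" and i j
  assume "length xs = n" "i < j" "j < n"
  then show "f (map g (xs[i := xs ! j, j := xs ! i])) = - f (map g xs)"
    using skew_multilinear_swap[OF f, of "map g xs" i j] by (simp add: map_update)
qed

lemma skew_multilinear_add: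
  assumes "skew_multilinear n sV sW f" "skew_multilinear n sV sW g"
  shows "skew_multilinear n sV sW (\<lambda>xs. f xs + g xs)"
proof -
  have "Vector_Spaces.linear sV sW (\<lambda>x. f (xs[i := x]) + g (xs[i := x]))"
    if "length xs = n" "i < n" for xs i
    using skew_multilinear_linear[OF assms(1) that] skew_multilinear_linear[OF assms(2) that]
    by (simp add: Vector_Spaces.linear_iff vector_space_def add_ac)
  then show ?thesis
    using assms by (simp add: skew_multilinear_def)
qed

section \<open>Direct sums of modules\<close>

lemma fst_sum_scale [simp]: "fst (sum_scale f g s z) = f s (fst z)"
  and snd_sum_scale [simp]: "snd (sum_scale f g s z) = g s (snd z)"
  by (simp_all add: sum_scale_def)

lemma vector_space_sum_scale:
  assumes "vector_space s1" "vector_space s2"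
  shows "vector_space (sum_scale s1 s2)"
proof -
  interpret V: vector_space s1 by fact
  interpret W: vector_space s2 by fact
  show ?thesis
    by unfold_locales
      (simp_all add: prod_eq_iff V.scale_right_distrib W.scale_right_distrib
        V.scale_left_distrib W.scale_left_distrib)
qed

lemma linear_fst_sum_scale:
  "vector_space s1 \<Longrightarrow> vector_space s2 \<Longrightarrow> Vector_Spaces.linear (sum_scale s1 s2) s1 fst"
  by (simp add: Vector_Spaces.linear_iff vector_space_sum_scale)

lemma skew_multilinear_Pair:
  assumes "skew_multilinear n sV s1 f" "skew_multilinear n sV s2 g"
  shows "skew_multilinear n sV (sum_scale s1 s2) (\<lambda>xs. (f xs, g xs))"
proof -
  have "Vector_Spaces.linear sV (sum_scale s1 s2) (\<lambda>x. (f (xs[i := x]), g (xs[i := x])))"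
    if "length xs = n" "i < n" for xs i
    using skew_multilinear_linear[OF assms(1) that] skew_multilinear_linear[OF assms(2) that]
    by (simp add: Vector_Spaces.linear_iff vector_space_sum_scale prod_eq_iff)
  then show ?thesis
    using assms by (simp add: skew_multilinear_def prod_eq_iff)
qed

lemma algebra_module_sum_scale:
  assumes "algebra_module sA sL aL" "algebra_module sA sM aM"
  shows "algebra_module sA (sum_scale sL sM) (sum_scale aL aM)"
proof -
  interpret V: algebra_module sA sL aL by fact
  interpret W: algebra_module sA sM aM by fact
  interpret S: vector_space "sum_scale sL sM"
    by (rule vector_space_sum_scale) unfold_locales
  show ?thesis
  proof
    show "sum_scale aL aM e m = m" if "\<And>a. e * a = a" for e m
      using that by (simp add: prod_eq_iff V.act_unital W.act_unital)
  qed (use V.act_linear W.act_linear V.linear_act W.linear_act in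
      \<open>simp_all add: prod_eq_iff Vector_Spaces.linear_iff V.act_act W.act_act\<close>)
qed

section \<open>The bracket on the direct sum\<close>

context n_Lie_Rinehart_representation
begin

section \<open>The representation \<open>psi\<close> and its contribution to the bracket\<close>

lemma psi_add: "length xs = n - 1 \<Longrightarrow> psi xs (m + m') = psi xs m + psi xs m'"
  and psi_scale: "length xs = n - 1 \<Longrightarrow> psi xs (sM c m) = sM c (psi xs m)"
  using M.rho_endomorphism[of xs] by (simp_all add: Vector_Spaces.linear_iff)

lemma psi_zero: "length xs = n - 1 \<Longrightarrow> psi xs 0 = 0"
  using psi_add[of xs 0 0] by simp

lemma psi_sum: "length xs = n - 1 \<Longrightarrow> psi xs (\<Sum>i\<in>I. g i) = (\<Sum>i\<in>I. psi xs (g i))"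
  by (induction I rule: infinite_finite_induct) (simp_all add: psi_zero psi_add)

lemma psi_swap:
  "length xs = n - 1 \<Longrightarrow> i < j \<Longrightarrow> j < n - 1 \<Longrightarrow> psi (xs[i := xs ! j, j := xs ! i]) m = - psi xs m"
  using skew_multilinear_swap[OF M.rho_skew_multilinear] .

lemma aM_minus: "aM a (- m) = - aM a m"
proof -
  interpret Vector_Spaces.linear sM sM "aM a" by (rule M.act_linear)
  show ?thesis by (rule neg)
qed

lemma aM_add: "aM a (m + m') = aM a m + aM a m'"
  using M.act_linear[of a] by (simp add: Vector_Spaces.linear_iff)

lemma aM_scale: "aM a (sM c m) = sM c (aM a m)"
  using M.act_linear[of a] by (simp add: Vector_Spaces.linear_iff)

lemma aM_sum: "aM a (\<Sum>i\<in>I. g i) = (\<Sum>i\<in>I. aM a (g i))"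
proof -
  interpret Vector_Spaces.linear sM sM "aM a" by (rule M.act_linear)
  show ?thesis by (rule sum)
qed

text \<open>The axiom gives \<open>A\<close>-linearity in the first argument, whereas the Leibniz
  rule of the bracket puts the scalar into the last one; skew symmetry connects the two.\<close>

lemma psi_act_last:
  assumes "length xs = n - 2"
  shows "psi (xs @ [aL a x]) m = aM a (psi (xs @ [x]) m)"
proof -
  have first: "psi (ys[0 := aL a (ys ! 0)]) m = aM a (psi ys m)" if len: "length ys = n - 1" for ys
  proof -
    obtain y ys' where "ys = y # ys'" "length ys' = n - 2"
      using len n_ge_2 by (cases ys) auto
    then show ?thesis by (simp add: psi_act)
  qed
  have "psi ((xs @ [x])[n - 2 := aL a ((xs @ [x]) ! (n - 2))]) m = aM a (psi (xs @ [x]) m)"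
  proof (rule skew_update_transfer[OF M.rho_skew_multilinear, where p = 0])
    show "psi (ys[0 := aL a (ys ! 0)]) m = aM a (psi ys m)" if "length ys = n - 1" for ys
      using that by (rule first)
  qed (use n_ge_2 assms in \<open>simp_all add: aM_minus\<close>)
  \<comment> \<open>Writing \<open>n - 2\<close> as \<open>length xs\<close> lets the update be
    evaluated at the appended entry.\<close>
  then show ?thesis
    unfolding assms[symmetric] by simp
qed

text \<open>The \<open>M\<close>-component of the semidirect product bracket, that is, of
  \<open>ext_bracket\<close> with \<open>theta\<close> equal to zero. Separating it isolates what
  follows from the representation axioms.\<close>

definition correction :: "('l \<times> 'm) list \<Rightarrow> 'm" where
  "correction zs = (\<Sum>k<n. sM ((- 1) ^ (n - 1 - k)) (psi (omit k (map fst zs)) (snd (zs ! k))))"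

text \<open>Summand \<open>k\<close> is linear in slot \<open>i\<close> through the endomorphism
  when \<open>i = k\<close>, and through multilinearity of \<open>psi\<close> otherwise. For skew
  symmetry, adjacent swaps suffice.\<close>

lemma correction_skew_multilinear: "skew_multilinear n (sum_scale sL sM) sM correction"
  unfolding skew_multilinear_def
proof (intro conjI allI impI)
  fix zs :: "('l \<times> 'm) list" and i
  assume zs: "length zs = n" "i < n"
  have vs: "vector_space (sum_scale sL sM)"
    by (rule vector_space_sum_scale) unfold_locales
  have "Vector_Spaces.linear (sum_scale sL sM) sM
      (\<lambda>z. psi (omit k (map fst (zs[i := z]))) (snd (zs[i := z] ! k)))" if "k < n" for k
  proof (cases "i = k")
    case True
    with zs that show ?thesis
      by (simp add: Vector_Spaces.linear_iff vs M.M.vector_space_axioms map_update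
          omit_update_same length_omit psi_add psi_scale)
  next
    case False
    \<comment> \<open>Entries behind the omitted position move down by one.\<close>
    let ?p = "if i < k then i else i - 1"
    from zs that False
    have eq: "psi (omit k (map fst (zs[i := z]))) (snd (zs[i := z] ! k))
      = psi ((omit k (map fst zs))[?p := fst z]) (snd (zs ! k))" for z
      by (simp add: map_update omit_update)
    have "Vector_Spaces.linear sL sM (\<lambda>x. psi ((omit k (map fst zs))[?p := x]) (snd (zs ! k)))"
      using zs that False
      by (intro skew_multilinear_linear[OF M.rho_skew_multilinear]) (auto simp: length_omit)
    then show ?thesis
      unfolding eq by (simp add: Vector_Spaces.linear_iff vs)
  qed
  then show "Vector_Spaces.linear (sum_scale sL sM) sM (\<lambda>z. correction (zs[i := z]))"
    by (simp add: Vector_Spaces.linear_iff correction_def vs M.M.vector_space_axioms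
        M.M.scale_right_distrib sum.distrib M.M.scale_sum_right mult.commute)
next
  fix zs :: "('l \<times> 'm) list" and i j
  assume "length zs = n" "i < j" "j < n"
  then show "correction (zs[i := zs ! j, j := zs ! i]) = - correction zs"
  proof (rule skew_if_adjacent_skew[rotated])
    fix zs :: "('l \<times> 'm) list" and i
    assume zs: "length zs = n" and i: "Suc i < n"
    define zs' where "zs' = zs[i := zs ! Suc i, Suc i := zs ! i]"
    define t where "t = (\<lambda>zs :: ('l \<times> 'm) list. \<lambda>k.
      sM ((- 1) ^ (n - 1 - k)) (psi (omit k (map fst zs)) (snd (zs ! k))))"
    have split: "correction ws = t ws i + t ws (Suc i) + (\<Sum>k\<in>{..<n} - {i} - {Suc i}. t ws k)" for ws
      using i by (simp add: correction_def t_def sum.remove[of "{..<n}" i]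
          sum.remove[of "{..<n} - {i}" "Suc i"] add.assoc)
    have sign: "(- 1 :: 'k) ^ (n - 1 - i) = - ((- 1) ^ (n - 1 - Suc i))"
    proof -
      have "n - 1 - i = Suc (n - 1 - Suc i)" using i by simp
      then show ?thesis by simp
    qed
    have map: "map fst zs' = (map fst zs)[i := map fst zs ! Suc i, Suc i := map fst zs ! i]"
      using zs i by (simp add: zs'_def map_update)
    \<comment> \<open>These two summands trade places, and the exponents of their signs differ by
      one.\<close>
    have "t zs' i = - t zs (Suc i)" "t zs' (Suc i) = - t zs i"
      using zs i omit_swap_adjacent[of i "map fst zs"]
      unfolding t_def map sign by (simp_all add: zs'_def M.M.scale_minus_left)
    \<comment> \<open>Since \<open>k\<close> avoids both swapped positions, they remain neighbours
      after \<open>k\<close> is omitted, so skew symmetry of \<open>psi\<close> applies.\<close>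
    moreover have "t zs' k = - t zs k" if "k < n" "k \<noteq> i" "k \<noteq> Suc i" for k
    proof -
      let ?xs = "omit k (map fst zs)" and ?i = "if i < k then i else i - 1"
      have "omit k (map fst zs') = ?xs[?i := ?xs ! Suc ?i, Suc ?i := ?xs ! ?i]"
        unfolding map using zs i that by (cases "i < k") (auto simp: omit_update nth_omit)
      moreover have "psi (?xs[?i := ?xs ! Suc ?i, Suc ?i := ?xs ! ?i]) m = - psi ?xs m" for m
        using zs i that by (intro psi_swap) (auto simp: length_omit)
      ultimately show ?thesis
        using that by (simp add: t_def zs'_def)
    qed
    ultimately show "correction (zs[i := zs ! Suc i, Suc i := zs ! i]) = - correction zs"
      unfolding split zs'_def[symmetric] by (simp add: sum_negf)
  qed
qed

text \<open>The term omitting the last position has sign one and only the outer arguments in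
  \<open>psi\<close>. Every other term keeps the last argument at the end of its list, the form in
  which the bracket axiom of \<open>psi\<close> is stated.\<close>

lemma correction_append:
  assumes "length us = n - 1"
  shows "correction (us @ [z]) = psi (map fst us) (snd z)
    + (\<Sum>j<n - 1. sM ((- 1) ^ (n - 1 - j)) (psi (omit j (map fst us) @ [fst z]) (snd (us ! j))))"
proof -
  have "{..<n} = insert (n - 1) {..<n - 1}" using n_ge_2 by auto
  then show ?thesis
    using assms by (simp add: correction_def omit_append nth_append)
qed

text \<open>Only the summand in which \<open>psi\<close> acts on \<open>snd z\<close> yields an
  anchor term, by the Leibniz rule of \<open>psi\<close>; in the others the scalar comes out by
  \<open>psi_act_last\<close>.\<close>

lemma correction_act:
  assumes "length us = n - 1"
  shows "correction (us @ [sum_scale aL aM a z])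
    = aM a (correction (us @ [z])) + aM (rho (map fst us) a) (snd z)"
  using assms n_ge_2
  by (simp add: correction_append psi_Leibniz psi_act_last length_omit aM_add aM_sum aM_scale
      add_ac)

text \<open>This is the \<open>M\<close>-component of the fundamental identity when
  \<open>theta\<close> is zero. Both sides expand into double sums that agree after exchanging the
  order of summation.\<close>

lemma correction_fundamental_identity:
  assumes us: "length us = n - 1" and zs: "length zs = n"
  defines "ys \<equiv> map fst us" and "xs \<equiv> map fst zs"
  shows "correction (us @ [(br xs, correction zs)])
    = (\<Sum>i<n. correction (zs[i := (br (ys @ [xs ! i]), correction (us @ [zs ! i]))]))"
proof -
  let ?s = "\<lambda>k. (- 1 :: 'k) ^ (n - 1 - k)"
  let ?d = "\<lambda>x. br (ys @ [x])"
  have len: "length ys = n - 1" "length xs = n"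
    using us zs by (simp_all add: ys_def xs_def)
  have nth: "fst (zs ! i) = xs ! i" if "i < n" for i
    using that zs by (simp add: xs_def)
  \<comment> \<open>\<open>omit j ys\<close> has length \<open>n - 2\<close>, as the bracket axiom
    of \<open>psi\<close> requires of its outer list.\<close>
  have outer: "sM (?s j) (psi (omit j ys @ [br xs]) (snd (us ! j)))
    = (\<Sum>i<n. sM (?s i) (psi (omit i xs)
        (sM (?s j) (psi (omit j ys @ [xs ! i]) (snd (us ! j))))))" if "j < n - 1" for j
    using that len M.rho_bracket[of "omit j ys" xs]
    by (simp add: length_omit psi_scale M.M.scale_sum_right mult.commute)
  \<comment> \<open>\<open>psi ys\<close> is moved past \<open>psi (omit k xs)\<close>; the
    commutator terms are reindexed by the positions other than \<open>k\<close>.\<close>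
  have inner: "psi ys (sM (?s k) (psi (omit k xs) (snd (zs ! k))))
    = sM (?s k) (psi (omit k xs) (psi ys (snd (zs ! k))))
      + (\<Sum>i\<in>{..<n} - {k}. sM (?s k) (psi (omit k (xs[i := ?d (xs ! i)])) (snd (zs ! k))))"
    if "k < n" for k
  proof -
    have "psi ys (psi (omit k xs) (snd (zs ! k)))
      = psi (omit k xs) (psi ys (snd (zs ! k)))
        + (\<Sum>i\<in>{..<n} - {k}. psi (omit k (xs[i := ?d (xs ! i)])) (snd (zs ! k)))"
      using M.rho_commutator[of ys "omit k xs" "snd (zs ! k)"] that len
        sum_update_omit[of k n xs "\<lambda>xs. psi xs (snd (zs ! k))" ?d]
      by (simp add: length_omit algebra_simps)
    then show ?thesis
      using len by (simp add: psi_scale M.M.scale_right_distrib M.M.scale_sum_right)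
  qed
  \<comment> \<open>Omitting \<open>i\<close> removes the bracket placed there, so summand
    \<open>i\<close> sees only \<open>m\<close>; all other summands see only the bracket.\<close>
  have update: "correction (zs[i := (?d (xs ! i), m)]) = sM (?s i) (psi (omit i xs) m)
      + (\<Sum>k\<in>{..<n} - {i}. sM (?s k) (psi (omit k (xs[i := ?d (xs ! i)])) (snd (zs ! k))))"
    if "i < n" for i m
    using that zs
    by (simp add: correction_def[of "zs[_ := _]"] sum.remove[of "{..<n}" i] map_update
        omit_update_same flip: xs_def)
  have rhs: "psi (omit i xs) (correction (us @ [zs ! i])) = psi (omit i xs) (psi ys (snd (zs ! i)))
      + (\<Sum>j<n - 1. psi (omit i xs) (sM (?s j) (psi (omit j ys @ [xs ! i]) (snd (us ! j)))))"
    if "i < n" for i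
    using that us len
    by (simp add: correction_append psi_add psi_sum length_omit nth flip: ys_def)
  \<comment> \<open>The inner range depends on the outer index, but the condition that both differ
    is symmetric, so the order can still be exchanged.\<close>
  have swap: "(\<Sum>k<n. \<Sum>i\<in>{..<n} - {k}. g i k) = (\<Sum>i<n. \<Sum>k\<in>{..<n} - {i}. g i k)"
    for g :: "nat \<Rightarrow> nat \<Rightarrow> 'm"
  proof -
    have "(\<Sum>k<n. \<Sum>i\<in>{..<n} - {k}. g i k) = (\<Sum>k<n. \<Sum>i | i \<in> {..<n} \<and> i \<noteq> k. g i k)"
      by (intro sum.cong) auto
    also have "\<dots> = (\<Sum>i<n. \<Sum>k | k \<in> {..<n} \<and> i \<noteq> k. g i k)"
      by (rule sum.swap_restrict) auto
    also have "\<dots> = (\<Sum>i<n. \<Sum>k\<in>{..<n} - {i}. g i k)"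
      by (intro sum.cong) auto
    finally show ?thesis .
  qed
  have "correction (us @ [(br xs, correction zs)])
    = (\<Sum>k<n. psi ys (sM (?s k) (psi (omit k xs) (snd (zs ! k)))))
      + (\<Sum>j<n - 1. sM (?s j) (psi (omit j ys @ [br xs]) (snd (us ! j))))"
    using us len
    by (simp add: correction_append correction_def[of zs] psi_sum flip: xs_def ys_def)
  also have "\<dots> = (\<Sum>k<n. sM (?s k) (psi (omit k xs) (psi ys (snd (zs ! k)))))
      + (\<Sum>k<n. \<Sum>i\<in>{..<n} - {k}. sM (?s k) (psi (omit k (xs[i := ?d (xs ! i)])) (snd (zs ! k))))
      + (\<Sum>j<n - 1. \<Sum>i<n. sM (?s i) (psi (omit i xs)
        (sM (?s j) (psi (omit j ys @ [xs ! i]) (snd (us ! j))))))"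
    \<comment> \<open>The deleted rules would rewrite the exponents before \<open>inner\<close> and
      \<open>outer\<close> can match.\<close>
    by (simp add: inner outer sum.distrib del: diff_diff_left One_nat_def)
  also have "\<dots> = (\<Sum>k<n. sM (?s k) (psi (omit k xs) (psi ys (snd (zs ! k)))))
      + (\<Sum>i<n. \<Sum>k\<in>{..<n} - {i}. sM (?s k) (psi (omit k (xs[i := ?d (xs ! i)])) (snd (zs ! k))))
      + (\<Sum>i<n. \<Sum>j<n - 1. sM (?s i) (psi (omit i xs)
        (sM (?s j) (psi (omit j ys @ [xs ! i]) (snd (us ! j))))))"
    by (intro arg_cong2[where f = "(+)"] refl swap sum.swap)
  also have "\<dots> = (\<Sum>i<n. correction (zs[i := (?d (xs ! i), correction (us @ [zs ! i]))]))"
    by (simp add: update rhs M.M.scale_right_distrib M.M.scale_sum_right sum.distrib)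
  finally show ?thesis .
qed

text \<open>This and the next lemma split off the contribution of \<open>theta\<close> when a
  bracket is inserted as an argument, leaving pure corrections to which
  \<open>correction_fundamental_identity\<close> applies.\<close>

lemma correction_add_last:
  assumes "length us = n - 1"
  shows "correction (us @ [(x, m + m')]) = psi (map fst us) m + correction (us @ [(x, m')])"
  using assms by (simp add: correction_append psi_add add.assoc)

lemma correction_update_add:
  assumes "length zs = n" "i < n"
  shows "correction (zs[i := (x, m + m')])
    = sM ((- 1) ^ (n - 1 - i)) (psi (omit i (map fst zs)) m) + correction (zs[i := (x, m')])"
  using assms
  by (simp add: correction_def sum.remove[of "{..<n}" i] map_update omit_update_same length_omit
      psi_add M.M.scale_right_distrib add.assoc)

section \<open>The axioms of the extension in terms of \<open>theta\<close>\<close>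

lemma ext_bracket_eq:
  "ext_bracket n br sM psi theta zs = (br (map fst zs), theta (map fst zs) + correction zs)"
  by (simp add: ext_bracket_def correction_def)

text \<open>Fixing the arguments allows comparison with the fundamental identity instance by
  instance.\<close>

definition cocycle_equation :: "('l list \<Rightarrow> 'm) \<Rightarrow> 'l list \<Rightarrow> 'l list \<Rightarrow> bool" where
  "cocycle_equation theta ys xs \<longleftrightarrow> theta (ys @ [br xs])
    = (\<Sum>i<n. theta (xs[i := br (ys @ [xs ! i])]))
      + (\<Sum>i<n. sM ((- 1) ^ (n - 1 - i)) (psi (omit i xs) (theta (ys @ [xs ! i]))))
      - psi ys (theta xs)"

text \<open>The \<open>L\<close>-components agree by the fundamental identity of \<open>L\<close>.
  In the \<open>M\<close>-components the pure corrections cancel by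
  \<open>correction_fundamental_identity\<close>, which leaves an equation free of the
  \<open>M\<close>-components of the arguments.\<close>

lemma ext_fundamental_identity_iff:
  fixes theta :: "'l list \<Rightarrow> 'm"
  assumes us: "length us = n - 1" and zs: "length zs = n"
  defines "B \<equiv> ext_bracket n br sM psi theta"
  shows "B (us @ [B zs]) = (\<Sum>i<n. B (zs[i := B (us @ [zs ! i])]))
    \<longleftrightarrow> cocycle_equation theta (map fst us) (map fst zs)"
proof -
  define ys xs where "ys = map fst us" and "xs = map fst zs"
  have len: "length ys = n - 1" "length xs = n"
    using us zs by (simp_all add: ys_def xs_def)
  have nth: "fst (zs ! i) = xs ! i" if "i < n" for i
    using that zs by (simp add: xs_def)
  have lhs: "B (us @ [B zs]) = (br (ys @ [br xs]),
    theta (ys @ [br xs]) + psi ys (theta xs) + correction (us @ [(br xs, correction zs)]))"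
    using us by (simp add: B_def ext_bracket_eq correction_add_last add.assoc flip: ys_def xs_def)
  have rhs: "B (zs[i := B (us @ [zs ! i])]) = (br (xs[i := br (ys @ [xs ! i])]),
      theta (xs[i := br (ys @ [xs ! i])])
      + sM ((- 1) ^ (n - 1 - i)) (psi (omit i xs) (theta (ys @ [xs ! i])))
      + correction (zs[i := (br (ys @ [xs ! i]), correction (us @ [zs ! i]))]))"
    if "i < n" for i
    using that us zs nth
    by (simp add: B_def ext_bracket_eq correction_update_add map_update add.assoc
        flip: ys_def xs_def)
  have "B (us @ [B zs]) = (\<Sum>i<n. B (zs[i := B (us @ [zs ! i])])) \<longleftrightarrow>
    theta (ys @ [br xs]) + psi ys (theta xs)
    = (\<Sum>i<n. theta (xs[i := br (ys @ [xs ! i])]))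
      + (\<Sum>i<n. sM ((- 1) ^ (n - 1 - i)) (psi (omit i xs) (theta (ys @ [xs ! i]))))"
    using fundamental_identity[OF len]
      correction_fundamental_identity[OF us zs, folded ys_def xs_def]
    by (simp add: lhs rhs sum.distrib prod_eq_iff fst_sum snd_sum)
  then show ?thesis
    by (auto simp: cocycle_equation_def eq_diff_eq simp flip: ys_def xs_def)
qed

lemma ext_bracket_skew_multilinear:
  assumes theta: "skew_multilinear n sL sM theta"
  shows "skew_multilinear n (sum_scale sL sM) (sum_scale sL sM) (ext_bracket n br sM psi theta)"
proof -
  have fst: "Vector_Spaces.linear (sum_scale sL sM) sL fst"
    by (rule linear_fst_sum_scale) unfold_locales
  have "ext_bracket n br sM psi theta
      = (\<lambda>zs. (br (map fst zs), theta (map fst zs) + correction zs))"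
    by (rule ext) (rule ext_bracket_eq)
  then show ?thesis
    by (simp add: skew_multilinear_Pair skew_multilinear_add correction_skew_multilinear
        skew_multilinear_compose[OF br_skew_multilinear fst] skew_multilinear_compose[OF theta fst])
qed

text \<open>The \<open>L\<close>-component is the Leibniz rule of \<open>L\<close>, and the anchor
  term on \<open>M\<close> is absorbed by \<open>correction_act\<close>; what is left concerns
  \<open>theta\<close> alone.\<close>

lemma ext_bracket_act_iff:
  fixes theta :: "'l list \<Rightarrow> 'm"
  assumes "length us = n - 1"
  defines "B \<equiv> ext_bracket n br sM psi theta"
  shows "B (us @ [sum_scale aL aM a z])
      = sum_scale aL aM a (B (us @ [z])) + sum_scale aL aM (ext_anchor rho us a) z
    \<longleftrightarrow> theta (map fst us @ [aL a (fst z)]) = aM a (theta (map fst us @ [fst z]))"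
  using assms br_act[of "map fst us" a "fst z"]
  by (simp add: ext_bracket_eq ext_anchor_def prod_eq_iff correction_act aM_add add_ac)

text \<open>Brings the cochain condition into the shape produced by the Leibniz rule, with the
  scalar in the last slot; \<open>skew_update_transfer\<close> recovers the other slots.\<close>

lemma two_cocycle_iff:
  assumes theta: "skew_multilinear n sL sM theta"
  shows "two_cocycle n sL aL br sM aM psi theta \<longleftrightarrow>
    (\<forall>a xs x. length xs = n - 1 \<longrightarrow> theta (xs @ [aL a x]) = aM a (theta (xs @ [x]))) \<and>
    (\<forall>ys xs. length ys = n - 1 \<longrightarrow> length xs = n \<longrightarrow> cocycle_equation theta ys xs)"
proof -
  have "(\<forall>xs i a. length xs = n \<longrightarrow> i < n \<longrightarrow> theta (xs[i := aL a (xs ! i)]) = aM a (theta xs))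
    \<longleftrightarrow> (\<forall>a xs x. length xs = n - 1 \<longrightarrow> theta (xs @ [aL a x]) = aM a (theta (xs @ [x])))"
    (is "?all \<longleftrightarrow> ?last")
  proof
    assume all: ?all
    show ?last
    proof (intro allI impI)
      fix a x and xs :: "'l list"
      assume "length xs = n - 1"
      then show "theta (xs @ [aL a x]) = aM a (theta (xs @ [x]))"
        using all[rule_format, of "xs @ [x]" "n - 1" a] n_ge_2
        by (simp add: nth_append list_update_append)
    qed
  next
    assume ?last
    have last: "theta (xs[n - 1 := aL a (xs ! (n - 1))]) = aM a (theta xs)" if "length xs = n" for a xs
      using that n_ge_2 \<open>?last\<close>[rule_format, of "butlast xs" a "last xs"]
      by (cases xs rule: rev_cases) (auto simp: nth_append list_update_append)
    show ?all
    proof (intro allI impI)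
      fix xs :: "'l list" and i a
      assume xs: "length xs = n" "i < n"
      show "theta (xs[i := aL a (xs ! i)]) = aM a (theta xs)"
      proof (rule skew_update_transfer[where p = "n - 1" and S = "aL a" and T = "aM a",
            OF theta aM_minus])
        show "theta (xs[n - 1 := aL a (xs ! (n - 1))]) = aM a (theta xs)" if "length xs = n" for xs
          using that by (rule last)
      qed (use xs in simp_all)
    qed
  qed
  then show ?thesis
    using theta unfolding two_cocycle_def two_cochain_def cocycle_equation_def by blast
qed

text \<open>The remaining axioms hold for every skew multilinear \<open>theta\<close>: the module
  axioms are componentwise, and the anchor axioms reduce to those of \<open>rho\<close>, since the
  anchor sees only first components and \<open>fst_B\<close> identifies that of the bracket.\<close>

lemma n_Lie_Rinehart_ext_iff:
  assumes theta: "skew_multilinear n sL sM theta"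
  defines "S \<equiv> sum_scale sL sM" and "act \<equiv> sum_scale aL aM"
    and "B \<equiv> ext_bracket n br sM psi theta"
  shows "n_Lie_Rinehart n sA S act B (ext_anchor rho) \<longleftrightarrow>
    (\<forall>us zs. length us = n - 1 \<longrightarrow> length zs = n \<longrightarrow>
      B (us @ [B zs]) = (\<Sum>i<n. B (zs[i := B (us @ [zs ! i])]))) \<and>
    (\<forall>us a z. length us = n - 1 \<longrightarrow>
      B (us @ [act a z]) = act a (B (us @ [z])) + act (ext_anchor rho us a) z)"
    (is "?ext \<longleftrightarrow> ?FI \<and> ?Leibniz")
proof
  assume ?ext
  then interpret E: n_Lie_Rinehart n sA S act B "ext_anchor rho" .
  show "?FI \<and> ?Leibniz"
    using E.fundamental_identity E.br_act by blast
next
  assume R: "?FI \<and> ?Leibniz"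
  have fst: "Vector_Spaces.linear S sL fst"
    unfolding S_def by (rule linear_fst_sum_scale) unfold_locales
  have fst_B: "fst (B zs) = br (map fst zs)" for zs
    by (simp add: B_def ext_bracket_eq)
  have "algebra_module sA sM aM" "algebra_module sA sL aL"
    by unfold_locales
  then have module: "algebra_module sA S act"
    unfolding S_def act_def by (intro algebra_module_sum_scale)
  show ?ext
  proof (intro n_Lie_Rinehart.intro n_Lie_representation.intro n_Lie_algebra.intro
      n_Lie_Rinehart_axioms.intro n_Lie_representation_axioms.intro n_Lie_algebra_axioms.intro)
    show "algebra_module sA S act" by (rule module)
    then show "vector_space S" by (rule algebra_module.axioms)
    show "vector_space sA" by (rule vector_space_axioms)
    show "2 \<le> n" by (rule n_ge_2)
    show "skew_multilinear n S S B"
      unfolding S_def B_def using theta by (rule ext_bracket_skew_multilinear)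
    show "B (us @ [B zs]) = (\<Sum>i<n. B (zs[i := B (us @ [zs ! i])]))"
      if "length us = n - 1" "length zs = n" for us zs
      using R that by blast
    show "Vector_Spaces.linear sA sA (ext_anchor rho us)"
      if "length us = n - 1" for us :: "('l \<times> 'm) list"
      using that by (simp add: ext_anchor_def rho_endomorphism)
    show "skew_multilinear (n - 1) S sA (\<lambda>us. ext_anchor rho us b)" for b
      unfolding ext_anchor_def by (rule skew_multilinear_compose[OF rho_skew_multilinear fst])
    show "ext_anchor rho us (ext_anchor rho vs b) - ext_anchor rho vs (ext_anchor rho us b)
      = (\<Sum>i<n - 1. ext_anchor rho (vs[i := B (us @ [vs ! i])]) b)"
      if "length us = n - 1" "length vs = n - 1" for us vs b
      using that rho_commutator[of "map fst us" "map fst vs" b]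
      by (simp add: ext_anchor_def map_update fst_B)
    show "ext_anchor rho (us @ [B zs]) b = (\<Sum>i<n. sA ((- 1) ^ (n - 1 - i))
        (ext_anchor rho (omit i zs) (ext_anchor rho (us @ [zs ! i]) b)))"
      if "length us = n - 2" "length zs = n" for us zs b
      using that rho_bracket[of "map fst us" "map fst zs" b]
      by (simp add: ext_anchor_def fst_B map_omit)
    show "derivation sA (ext_anchor rho us)"
      if "length us = n - 1" for us :: "('l \<times> 'm) list"
      using that by (simp add: ext_anchor_def rho_derivation)
    show "ext_anchor rho (act a z # us) b = a * ext_anchor rho (z # us) b"
      if "length us = n - 2" for us a z b
      using that by (simp add: ext_anchor_def act_def rho_act)
    show "B (us @ [act a z]) = act a (B (us @ [z])) + act (ext_anchor rho us a) z"
      if "length us = n - 1" for us a z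
      using R that by blast
  qed
qed

end

theorem theorem5p4:
  fixes n :: nat
    and sA :: "'k::field_char_0 \<Rightarrow> 'a::comm_ring \<Rightarrow> 'a"
    and sL :: "'k \<Rightarrow> 'l::ab_group_add \<Rightarrow> 'l"
    and aL :: "'a \<Rightarrow> 'l \<Rightarrow> 'l"
    and br :: "'l list \<Rightarrow> 'l"
    and rho :: "'l list \<Rightarrow> 'a \<Rightarrow> 'a"
    and sM :: "'k \<Rightarrow> 'm::ab_group_add \<Rightarrow> 'm"
    and aM :: "'a \<Rightarrow> 'm \<Rightarrow> 'm"
    and psi :: "'l list \<Rightarrow> 'm \<Rightarrow> 'm"
    and theta :: "'l list \<Rightarrow> 'm"
  assumes "2 \<le> n"
    and "n_Lie_Rinehart n sA sL aL br rho"
    and "n_Lie_Rinehart_representation n sA sL aL br rho sM aM psi"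
    and "skew_multilinear n sL sM theta"
  shows "two_cocycle n sL aL br sM aM psi theta \<longleftrightarrow>
    n_Lie_Rinehart n sA (sum_scale sL sM) (sum_scale aL aM)
      (ext_bracket n br sM psi theta) (ext_anchor rho)"
proof -
  interpret n_Lie_Rinehart_representation n sA sL aL br rho sM aM psi by fact
  let ?B = "ext_bracket n br sM psi theta" and ?act = "sum_scale aL aM"
  \<comment> \<open>Each list in \<open>L\<close> is the projection of a list of pairs, obtained by
    padding with zero in \<open>M\<close>.\<close>
  have all_map_fst: "(\<forall>us :: ('l \<times> 'm) list. length us = k \<longrightarrow> P (map fst us))
    \<longleftrightarrow> (\<forall>xs. length xs = k \<longrightarrow> P xs)" for k P
  proof (intro iffI allI impI)
    fix xs :: "'l list"
    assume "\<forall>us :: ('l \<times> 'm) list. length us = k \<longrightarrow> P (map fst us)" "length xs = k"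
    then have "P (map fst (map (\<lambda>x. (x, 0 :: 'm)) xs))" by (metis length_map)
    then show "P xs" by (simp add: o_def)
  qed simp
  have "(\<forall>us zs. length us = n - 1 \<longrightarrow> length zs = n \<longrightarrow>
      ?B (us @ [?B zs]) = (\<Sum>i<n. ?B (zs[i := ?B (us @ [zs ! i])])))
    \<longleftrightarrow> (\<forall>us :: ('l \<times> 'm) list. length us = n - 1 \<longrightarrow> (\<forall>zs :: ('l \<times> 'm) list. length zs = n
      \<longrightarrow> cocycle_equation theta (map fst us) (map fst zs)))"
    using ext_fundamental_identity_iff by blast
  also have "\<dots> \<longleftrightarrow> (\<forall>ys xs. length ys = n - 1 \<longrightarrow> length xs = n \<longrightarrow> cocycle_equation theta ys xs)"
    \<comment> \<open>The first instance handles the inner quantifier with \<open>us\<close> fixed,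
      the second the outer one.\<close>
    unfolding all_map_fst[where P = "cocycle_equation theta (map fst us)" for us :: "('l \<times> 'm) list"]
      all_map_fst[where P = "\<lambda>ys. \<forall>xs. length xs = n \<longrightarrow> cocycle_equation theta ys xs"]
    by blast
  finally have FI: "(\<forall>us zs. length us = n - 1 \<longrightarrow> length zs = n \<longrightarrow>
      ?B (us @ [?B zs]) = (\<Sum>i<n. ?B (zs[i := ?B (us @ [zs ! i])]))) \<longleftrightarrow> \<dots>" .
  \<comment> \<open>\<open>z\<close> enters the condition on \<open>theta\<close> only through
    \<open>fst z\<close>, so it may be replaced by an arbitrary \<open>x\<close>.\<close>
  have "(\<forall>us a z. length us = n - 1 \<longrightarrow>
      ?B (us @ [?act a z]) = ?act a (?B (us @ [z])) + ?act (ext_anchor rho us a) z)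
    \<longleftrightarrow> (\<forall>us :: ('l \<times> 'm) list. length us = n - 1 \<longrightarrow> (\<forall>a x.
      theta (map fst us @ [aL a x]) = aM a (theta (map fst us @ [x]))))"
    using ext_bracket_act_iff by (metis fst_conv)
  also have "\<dots> \<longleftrightarrow> (\<forall>a xs x. length xs = n - 1 \<longrightarrow> theta (xs @ [aL a x]) = aM a (theta (xs @ [x])))"
    unfolding all_map_fst[where P = "\<lambda>xs. \<forall>a x. theta (xs @ [aL a x]) = aM a (theta (xs @ [x]))"]
    by blast
  finally have Leibniz: "(\<forall>us a z. length us = n - 1 \<longrightarrow>
      ?B (us @ [?act a z]) = ?act a (?B (us @ [z])) + ?act (ext_anchor rho us a) z) \<longleftrightarrow> \<dots>" .
  show ?thesis
    unfolding two_cocycle_iff[OF assms(4)] n_Lie_Rinehart_ext_iff[OF assms(4)] FI Leibniz by blast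
qed

end
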